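(* Let $f_\nu(x)=(1+x)\,\mathrm{cosb}_\nu(x)^2=\sum_{m\ge0}a_mx^m/m!$ and $\ddot H_{n}(f_\nu)=\det(a_{2i+j})_{0\le i,j\le n-1}$. For every $N\ge1$, as an identity in $\mathbb Q(\nu)$, $$\ddot H_{2N}(f_\nu) =(-1)^N\,2^{\binom{2N}2}\, \prod_{i=0}^{2N-1}(2i)!\; \prod_{k=0}^{N-1}(\tfrac12)_k\,\bigl((\nu+\tfrac12)_k\bigr)^{2}\,(2\nu+\tfrac12)_k \; \prod_{i=0}^{2N-1} \frac{(\nu+\tfrac12)_i}{(\nu+1)_{N-1+i}\,(2\nu+1)_{N-1+i}}\,.$$ Moreover the rational function $\ddot H_{2N}(f_\nu)$ is regular at every $\nu\notin\{-1,-2,\dots\}$, so the identity may be specialised at each such $\nu$ after the cancellations between the factors of the $(2\nu+1)_{N-1+i}$ and the half-integer numerator factors.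
   Context: $\mathrm{cosb}_\nu$ is the normalised Bessel function $\mathrm{cosb}_\nu(x)=\Gamma(\nu+1)(2/x)^\nu J_\nu(x)=\sum_{k\ge0}\frac{(-1)^k}{4^k\,k!\,(\nu+1)_k}x^{2k}$, viewed as a power series in $x$ with coefficients in $\mathbb Q(\nu)$. $(\gamma)_m=\gamma(\gamma+1)\cdots(\gamma+m-1)$ is the Pochhammer symbol; empty products equal $1$. *)

theory Defs
  imports
    "Jordan_Normal_Form.Determinant"
    "HOL-Computational_Algebra.Computational_Algebra"
    "HOL-Computational_Algebra.Field_as_Ring"
begin

text \<open>
  The parameter \<open>\<nu>\<close> ranges over an arbitrary field of characteristic 0, so that one definition
  serves both for the generic parameter in the field \<open>rat poly fract\<close> of rational functions
  and for its specialisations at complex numbers.  Since division by 0 yields 0, the series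
  \<open>cosb \<nu>\<close> is only meaningful when \<open>\<nu>\<close> is not a negative integer of the field.
\<close>

definition cosb :: "'a::field_char_0 \<Rightarrow> 'a fps" where
  "cosb \<nu> = Abs_fps (\<lambda>n. if even n
      then (-1) ^ (n div 2) / (4 ^ (n div 2) * fact (n div 2) * pochhammer (\<nu> + 1) (n div 2))
      else 0)"

definition f_nu :: "'a::field_char_0 \<Rightarrow> 'a fps" where
  "f_nu \<nu> = (1 + fps_X) * (cosb \<nu>)\<^sup>2"

definition egf_coeff :: "'a::field_char_0 fps \<Rightarrow> nat \<Rightarrow> 'a" where
  "egf_coeff f m = fact m * fps_nth f m"

definition hankel2 :: "nat \<Rightarrow> 'a::field_char_0 fps \<Rightarrow> 'a" where
  "hankel2 n f = det (mat n n (\<lambda>(i, j). egf_coeff f (2 * i + j)))"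

definition product_side :: "nat \<Rightarrow> 'a::field_char_0 \<Rightarrow> 'a" where
  "product_side N \<nu> =
     (-1) ^ N * 2 ^ ((2 * N) choose 2)
     * (\<Prod>i<2 * N. fact (2 * i))
     * (\<Prod>k<N. pochhammer (1 / 2) k * (pochhammer (\<nu> + 1 / 2) k)\<^sup>2 * pochhammer (2 * \<nu> + 1 / 2) k)
     * (\<Prod>i<2 * N. pochhammer (\<nu> + 1 / 2) i /
          (pochhammer (\<nu> + 1) (N - 1 + i) * pochhammer (2 * \<nu> + 1) (N - 1 + i)))"

text \<open>The indeterminate \<open>\<nu>\<close> of the field of rational functions over the rationals.\<close>

definition nu_var :: "rat poly fract" where
  "nu_var = Fraction_Field.Fract [:0, 1:] 1"

text \<open>
  \<open>quot_of_fract r\<close> is the pair of numerator and denominator of \<open>r\<close> in lowest terms; hence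
  \<open>ratfun_value r z\<close> is the value of \<open>r\<close> at \<open>z\<close> after all cancellations, provided that
  \<open>r\<close> is regular at \<open>z\<close>.
\<close>

definition regular_at :: "rat poly fract \<Rightarrow> complex \<Rightarrow> bool" where
  "regular_at r z \<longleftrightarrow> poly (map_poly of_rat (snd (quot_of_fract r))) z \<noteq> 0"

definition ratfun_value :: "rat poly fract \<Rightarrow> complex \<Rightarrow> complex" where
  "ratfun_value r z = poly (map_poly of_rat (fst (quot_of_fract r))) z /
                      poly (map_poly of_rat (snd (quot_of_fract r))) z"

end

theory Submission
  imports Defs
begin

text \<open>
  The Clausen-type formula for \<open>(cosb \<nu>)\<^sup>2\<close>, a case of Chu--Vandermonde, makes the coefficients
  \<open>a\<^sub>m\<close> hypergeometric, with \<open>a\<^bsub>2k+1\<^esub> = (2 k + 1) a\<^bsub>2k\<^esub>\<close>. Up to a factor depending on \<open>i\<close> and one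
  depending on \<open>j\<close>, the entry \<open>a\<^bsub>2i+j\<^esub>\<close> is then the value at \<open>i\<close> of a polynomial of degree less
  than \<open>2 N\<close>, namely \<open>e\<^sub>j R\<^sub>l\<close> with \<open>l = \<lfloor>j / 2\<rfloor>\<close> and
  \<open>R\<^sub>l(x) = (x + 2 \<nu> + 1 + l)\<^bsub>N-1-l\<^esub> (x + \<nu> + 1 + l)\<^bsub>N-1-l\<^esub>\<close>. Here \<open>e\<^sub>j\<close> is the Newton basis for the
  interlaced nodes \<open>- 1/2, - (\<nu> + 1/2), - 3/2, - (\<nu> + 3/2), \<dots>\<close>, in which multiplication of \<open>e\<^sub>j\<close> by
  \<open>R\<^sub>l\<close> is triangular with diagonal entry the value of \<open>R\<^sub>l\<close> at the \<open>j\<close>-th node. The determinant is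
  therefore the Vandermonde determinant of \<open>0, \<dots>, 2 N - 1\<close> times the product of these values.

  For the specialisation, the entries of the matrix have no poles outside the negative integers,
  and evaluation at \<open>z\<close> is a ring homomorphism on the rational functions regular at \<open>z\<close>.
\<close>

subsection \<open>Determinants in a Newton basis\<close>

primrec newton :: "(nat \<Rightarrow> 'a::comm_ring_1) \<Rightarrow> nat \<Rightarrow> 'a poly" where
  "newton x 0 = 1"
| "newton x (Suc k) = newton x k * [:- x k, 1:]"

lemma newton_monic:
  shows degree_newton: "degree (newton x k :: 'a::idom poly) = k"
    and coeff_newton_same: "coeff (newton x k :: 'a poly) k = 1"
proof -
  have "degree (newton x k) = k \<and> lead_coeff (newton x k) = 1"
  proof (induction k)
    case (Suc k)
    moreover have "newton x k \<noteq> 0" using Suc by auto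
    ultimately have "degree (newton x (Suc k)) = Suc k"
      by (simp add: degree_mult_eq del: mult_pCons_right)
    moreover have "lead_coeff (newton x (Suc k)) = 1"
      unfolding newton.simps lead_coeff_mult using conjunct2[OF Suc] by simp
    ultimately show ?case by blast
  qed simp
  then show "degree (newton x k) = k" "coeff (newton x k) k = 1" by auto
qed

text \<open>Synthetic division at the node gives \<open>p = (X - x k) q + p (x k)\<close>, and the
  linear factor turns \<open>newton x k\<close> into \<open>newton x (Suc k)\<close>; induction then
  expands \<open>q\<close> from the next node on. The value of \<open>c 0\<close> is recorded
  because it becomes a diagonal entry of a triangular matrix.\<close>

lemma newton_expansion:
  fixes p :: "'a::comm_ring_1 poly"
  assumes "degree p \<le> d"
  shows "\<exists>c. newton x k * p = (\<Sum>m\<le>d. smult (c m) (newton x (k + m))) \<and> c 0 = poly p (x k)"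
  using assms
proof (induction d arbitrary: p k)
  case 0
  then obtain a where "p = [:a:]"
    using degree_eq_zeroE by blast
  then show ?case by (intro exI[of _ "\<lambda>_. a"]) simp
next
  case (Suc d)
  define q where "q = synthetic_div p (x k)"
  have "degree q \<le> d"
    using Suc.prems by (simp add: q_def degree_synthetic_div)
  from Suc.IH[OF this, of "Suc k"] obtain c where
    c: "newton x (Suc k) * q = (\<Sum>m\<le>d. smult (c m) (newton x (Suc k + m)))"
    by blast
  have p: "p = [:- x k, 1:] * q + [:poly p (x k):]"
    unfolding q_def by (rule synthetic_div_correct'[symmetric])
  have "newton x k * p = newton x (Suc k) * q + smult (poly p (x k)) (newton x k)"
    by (subst p) (simp add: distrib_left mult.assoc del: mult_pCons_left mult_pCons_right,
      simp)
  also have "\<dots> = (\<Sum>m\<le>Suc d. smult (case m of 0 \<Rightarrow> poly p (x k) | Suc m \<Rightarrow> c m) (newton x (k + m)))"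
    unfolding c by (subst sum.atMost_Suc_shift) simp
  finally show ?case by (intro exI[of _ "case_nat (poly p (x k)) c"]) simp
qed

lemma det_poly_eval:
  fixes x :: "nat \<Rightarrow> 'a::comm_ring_1"
  assumes "\<And>j. j < n \<Longrightarrow> degree (p j) < n"
  shows "det (mat n n (\<lambda>(i, j). poly (p j) (x i))) =
    det (mat n n (\<lambda>(i, j). x i ^ j)) * det (mat n n (\<lambda>(k, j). coeff (p j) k))"
proof -
  have "poly (p j) (x i) = (\<Sum>k<n. x i ^ k * coeff (p j) k)" if "j < n" for i j
    unfolding poly_altdef using assms[OF that]
    by (intro sum.mono_neutral_cong_left) (auto simp: coeff_eq_0 mult.commute)
  then have "mat n n (\<lambda>(i, j). poly (p j) (x i)) =
      mat n n (\<lambda>(i, j). x i ^ j) * mat n n (\<lambda>(k, j). coeff (p j) k)"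
    by (intro eq_matI) (auto simp: scalar_prod_def atLeast0LessThan)
  then show ?thesis by (simp add: det_mult[of _ n])
qed

text \<open>The coefficient matrix is unitriangular, so every monic basis yields the Vandermonde
  determinant of the points. This allows the nodes of a Newton basis to be exchanged at
  will.\<close>

lemma det_monic_eval:
  fixes x :: "nat \<Rightarrow> 'a::idom"
  assumes "\<And>j. degree (p j) = j" "\<And>j. coeff (p j) j = 1"
  shows "det (mat n n (\<lambda>(i, j). poly (p j) (x i))) = det (mat n n (\<lambda>(i, j). x i ^ j))"
proof -
  let ?C = "mat n n (\<lambda>(k, j). coeff (p j) k)"
  have "upper_triangular ?C"
    by (auto simp: assms coeff_eq_0)
  then have "det ?C = 1"
    by (subst det_upper_triangular[of _ n]) (auto simp: prod_list_diag_prod assms)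
  then show ?thesis
    using assms by (subst det_poly_eval) auto
qed

text \<open>The nodes \<open>x\<close> do not affect the determinant, so they are replaced by 0, 1,
  2, ... The Newton polynomials become falling factorials, which vanish at each
  \<open>i < j\<close>, and the matrix is lower triangular with diagonal entries
  \<open>fact i\<close>.\<close>

lemma det_newton_of_nat:
  "det (mat n n (\<lambda>(i, j). poly (newton x j) (of_nat i))) = (\<Prod>i<n. fact i :: 'a::field_char_0)"
proof -
  have eval: "poly (newton of_nat j) (of_nat i :: 'a) = (\<Prod>t<j. of_nat i - of_nat t)" for i j
    by (induction j) (simp_all add: algebra_simps)
  have fact: "(\<Prod>t<i. of_nat i - of_nat t :: 'a) = fact i" for i
  proof -
    have "(\<Prod>t<i. of_nat i - of_nat t :: 'a) = (\<Prod>t<i. of_nat (i - t))"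
      by (intro prod.cong) (auto simp: of_nat_diff)
    also have "\<dots> = of_nat (\<Prod>t<i. i - t)" by simp
    also have "(\<Prod>t<i. i - t) = fact i" by (simp add: fact_prod_rev atLeast0LessThan)
    finally show ?thesis by simp
  qed
  let ?F = "mat n n (\<lambda>(i, j). poly (newton of_nat j) (of_nat i :: 'a))"
  have "det (mat n n (\<lambda>(i, j). poly (newton x j) (of_nat i :: 'a))) = det ?F"
    by (subst (1 2) det_monic_eval) (simp_all add: newton_monic)
  also have "\<dots> = (\<Prod>i = 0..<n. ?F $$ (i, i))"
    by (subst det_lower_triangular[of n]) (auto simp: eval prod_list_diag_prod)
  also have "\<dots> = (\<Prod>i<n. fact i)"
    by (simp add: eval fact atLeast0LessThan)
  finally show ?thesis .
qed

text \<open>The degree bound keeps every product in the span of the first \<open>n\<close> Newton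
  polynomials. Multiplication is thus given by a square matrix, lower triangular since
  \<open>newton x j * R j\<close> involves only indices from \<open>j\<close> on.\<close>

lemma det_newton_mult_of_nat:
  fixes x :: "nat \<Rightarrow> 'a::field_char_0"
  assumes "\<And>j. j < n \<Longrightarrow> j + degree (R j) < n"
  shows "det (mat n n (\<lambda>(i, j). poly (newton x j * R j) (of_nat i))) =
    (\<Prod>i<n. fact i) * (\<Prod>j<n. poly (R j) (x j))"
proof -
  have "\<exists>c. newton x j * R j = (\<Sum>m<n. smult (c m) (newton x m)) \<and>
      c j = poly (R j) (x j) \<and> (\<forall>m<j. c m = 0)" if j: "j < n" for j
  proof -
    have "degree (R j) \<le> n - 1 - j" using assms[OF j] by linarith
    from newton_expansion[OF this, of x j] obtain c where
      c: "newton x j * R j = (\<Sum>m\<le>n - 1 - j. smult (c m) (newton x (j + m)))"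
        "c 0 = poly (R j) (x j)" by blast
    have "(\<Sum>m\<le>n - 1 - j. smult (c m) (newton x (j + m))) =
        (\<Sum>m\<in>{j..<n}. smult (c (m - j)) (newton x m))"
      by (rule sum.reindex_bij_witness[of _ "\<lambda>m. m - j" "\<lambda>m. m + j"])
        (use j in \<open>auto simp: add.commute\<close>)
    also have "\<dots> = (\<Sum>m<n. smult (if m < j then 0 else c (m - j)) (newton x m))"
      by (rule sum.mono_neutral_cong_left) auto
    finally show ?thesis
      using c by (intro exI[of _ "\<lambda>m. if m < j then 0 else c (m - j)"]) auto
  qed
  then obtain c where c: "\<And>j. j < n \<Longrightarrow> newton x j * R j = (\<Sum>m<n. smult (c j m) (newton x m))"
      "\<And>j. j < n \<Longrightarrow> c j j = poly (R j) (x j)" "\<And>j m. j < n \<Longrightarrow> m < j \<Longrightarrow> c j m = 0"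
    by metis
  let ?C = "mat n n (\<lambda>(m, j). c j m)"
  have "mat n n (\<lambda>(i, j). poly (newton x j * R j) (of_nat i)) =
      mat n n (\<lambda>(i, j). poly (newton x j) (of_nat i)) * ?C"
    by (intro eq_matI)
      (simp_all add: scalar_prod_def atLeast0LessThan c(1) poly_sum mult.commute[of "poly _ _"] del: poly_mult)
  moreover have "det ?C = (\<Prod>j<n. poly (R j) (x j))"
    by (subst det_lower_triangular[of n]) (auto simp: c prod_list_diag_prod atLeast0LessThan)
  ultimately show ?thesis
    by (simp add: det_mult[of _ n] det_newton_of_nat del: poly_mult)
qed

text \<open>In the Leibniz formula each permutation meets every row and every column once, so the
  scaling factors leave every term alike.\<close>

lemma det_scale_rows_cols:
  fixes r s :: "nat \<Rightarrow> 'a::comm_ring_1"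
  shows "det (mat n n (\<lambda>(i, j). r i * s j * A i j)) =
    (\<Prod>i<n. r i) * (\<Prod>j<n. s j) * det (mat n n (\<lambda>(i, j). A i j))"
proof -
  have "(\<Prod>i = 0..<n. r i * s (p i) * A i (p i)) =
      (\<Prod>i<n. r i) * (\<Prod>j<n. s j) * (\<Prod>i = 0..<n. A i (p i))" if "p permutes {0..<n}" for p
    using prod.permute[OF that, of s] by (simp add: prod.distrib atLeast0LessThan comp_def)
  moreover have "p i < n" if "p permutes {0..<n}" "i < n" for p i
    using permutes_in_image[OF that(1)] that(2) by auto
  ultimately show ?thesis
    by (subst (1 2) det_def'[of _ n]) (auto simp: sum_distrib_left mult_ac intro!: sum.cong)
qed

section \<open>Pochhammer symbols as polynomials, and interlaced nodes\<close>

lemma prod_lessThan_double: "(\<Prod>j<2 * n. g j) = (\<Prod>l<n. g (2 * l) * g (2 * l + 1 :: nat) :: 'a::comm_monoid_mult)"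
  by (induction n) (simp_all add: mult_ac)

lemma poly_pochhammer: "poly (pochhammer p n) y = pochhammer (poly p y) n"
  by (induction n) (simp_all add: pochhammer_Suc)

lemma degree_pochhammer_le:
  fixes p :: "'a::idom poly"
  assumes "degree p \<le> 1"
  shows "degree (pochhammer p n) \<le> n"
proof (induction n)
  case (Suc n)
  have "degree (p + of_nat n) \<le> 1"
    using assms by (intro degree_add_le) auto
  with Suc degree_mult_le[of "pochhammer p n" "p + of_nat n"] show ?case
    by (simp add: pochhammer_Suc)
qed simp

text \<open>The nodes are negated so that the Newton polynomials become products of rising
  factorials in \<open>y + a\<close> and \<open>y + b\<close>, gaining one factor of either kind in
  turn.\<close>

definition interlaced :: "'a::comm_ring_1 \<Rightarrow> 'a \<Rightarrow> nat \<Rightarrow> 'a" where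
  "interlaced a b j = (if even j then - a else - b) - of_nat (j div 2)"

lemma poly_newton_interlaced:
  "poly (newton (interlaced a b) (2 * l)) y = pochhammer (y + a) l * pochhammer (y + b) l"
  "poly (newton (interlaced a b) (Suc (2 * l))) y = pochhammer (y + a) (Suc l) * pochhammer (y + b) l"
proof -
  show *: "poly (newton (interlaced a b) (2 * l)) y = pochhammer (y + a) l * pochhammer (y + b) l"
    by (induction l) (simp_all add: interlaced_def pochhammer_Suc algebra_simps)
  show "poly (newton (interlaced a b) (Suc (2 * l))) y = pochhammer (y + a) (Suc l) * pochhammer (y + b) l"
    by (simp add: * interlaced_def pochhammer_Suc) (simp add: algebra_simps)
qed

text \<open>At \<open>i\<close> this is what remains of
  \<open>pochhammer c (N - 1 + i) * pochhammer d (N - 1 + i)\<close> after division by the same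
  product with \<open>i + l\<close> in place of \<open>N - 1 + i\<close>.\<close>

definition cofactor_poly :: "nat \<Rightarrow> 'a::comm_ring_1 \<Rightarrow> 'a \<Rightarrow> nat \<Rightarrow> 'a poly" where
  "cofactor_poly N c d l = pochhammer [:c + of_nat l, 1:] (N - 1 - l) * pochhammer [:d + of_nat l, 1:] (N - 1 - l)"

lemma poly_cofactor_poly:
  "poly (cofactor_poly N c d l) y =
    pochhammer (y + c + of_nat l) (N - 1 - l) * pochhammer (y + d + of_nat l) (N - 1 - l)"
  by (simp add: cofactor_poly_def poly_pochhammer algebra_simps)

lemma degree_cofactor_poly: "degree (cofactor_poly N c d l :: 'a::idom poly) \<le> 2 * (N - 1 - l)"
proof -
  have "degree (pochhammer [:e + of_nat l :: 'a, 1:] (N - 1 - l)) \<le> N - 1 - l" for e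
    by (rule degree_pochhammer_le) simp
  from this[of c] this[of d] show ?thesis
    unfolding cofactor_poly_def by (intro order.trans[OF degree_mult_le]) linarith
qed

text \<open>The degree bound holds because \<open>j\<close> is at most
  \<open>2 * (j div 2) + 1\<close>. At the node \<open>- a - l\<close> the shift by \<open>l\<close>
  in the cofactor cancels, leaving symbols in \<open>c - a\<close> and \<open>d - a\<close> of
  length \<open>N - 1 - l\<close>; likewise for \<open>b\<close>. Reversing the order of the factors
  gives the lengths \<open>k < N\<close>.\<close>

lemma det_newton_cofactor:
  fixes a b c d :: "'a::field_char_0"
  shows "det (mat (2 * N) (2 * N) (\<lambda>(i, j).
      poly (newton (interlaced a b) j * cofactor_poly N c d (j div 2)) (of_nat i))) =
    (\<Prod>i<2 * N. fact i) *
    (\<Prod>k<N. pochhammer (c - a) k * pochhammer (d - a) k * pochhammer (c - b) k * pochhammer (d - b) k)"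
proof -
  have deg: "j + degree (cofactor_poly N c d (j div 2)) < 2 * N" if "j < 2 * N" for j
    using degree_cofactor_poly[of N c d "j div 2"] that by linarith
  have "(\<Prod>j<2 * N. poly (cofactor_poly N c d (j div 2)) (interlaced a b j)) =
      (\<Prod>l<N. pochhammer (c - a) (N - Suc l) * pochhammer (d - a) (N - Suc l) *
        pochhammer (c - b) (N - Suc l) * pochhammer (d - b) (N - Suc l))"
    unfolding prod_lessThan_double
    by (intro prod.cong) (simp_all add: poly_cofactor_poly interlaced_def mult_ac)
  also have "\<dots> = (\<Prod>k<N. pochhammer (c - a) k * pochhammer (d - a) k * pochhammer (c - b) k * pochhammer (d - b) k)"
    by (rule prod.nat_diff_reindex)
  finally show ?thesis
    by (subst det_newton_mult_of_nat) (use deg in auto)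
qed

subsection \<open>The Hankel determinant\<close>

text \<open>The Cauchy product over even indices is a terminating Gauss series at 1, with upper
  parameters \<open>- \<nu> - k\<close> and \<open>- k\<close> and lower parameter
  \<open>\<nu> + 1\<close>. Chu-Vandermonde sums it, and the duplication formula brings the result
  into product form.\<close>

lemma cosb_square_nth:
  fixes \<nu> :: "'a::field_char_0"
  assumes nz: "\<And>n. pochhammer (\<nu> + 1) n \<noteq> 0" "\<And>n. pochhammer (2 * \<nu> + 1) n \<noteq> 0"
  shows "fps_nth ((cosb \<nu>)\<^sup>2) (2 * k) =
      (-1) ^ k * pochhammer (\<nu> + 1 / 2) k / (fact k * pochhammer (2 * \<nu> + 1) k * pochhammer (\<nu> + 1) k)"
    and "fps_nth ((cosb \<nu>)\<^sup>2) (Suc (2 * k)) = 0"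
proof -
  let ?c = "\<lambda>n. fps_nth (cosb \<nu>) n"
  show "fps_nth ((cosb \<nu>)\<^sup>2) (Suc (2 * k)) = 0"
    unfolding power2_eq_square fps_mult_nth
  proof (rule sum.neutral, safe)
    fix i assume "i \<in> {0..Suc (2 * k)}"
    then have "odd i \<or> odd (Suc (2 * k) - i)" by auto
    then show "?c i * ?c (Suc (2 * k) - i) = 0" by (auto simp: cosb_def)
  qed
  let ?q = "\<lambda>i. pochhammer (\<nu> + 1) i"
  \<comment> \<open>Reflection replaces the symbols of length \<open>k - i\<close> by symbols of
    length \<open>i\<close>, the shape required for Chu-Vandermonde. The two signs
    \<open>(-1) ^ i\<close> that arise cancel.\<close>
  have term_eq: "?c (2 * i) * ?c (2 * (k - i)) = (-1) ^ k / (4 ^ k * fact k * ?q k) *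
      (pochhammer (- \<nu> - of_nat k) i * pochhammer (- of_nat k) i / (of_nat (fact i) * ?q i))"
    if "i \<le> k" for i
  proof -
    have "?q k = ?q (k - i) * pochhammer (\<nu> + 1 + of_nat (k - i)) i"
      using pochhammer_product'[of "\<nu> + 1" "k - i" i] that by simp
    also have "pochhammer (\<nu> + 1 + of_nat (k - i)) i = (-1) ^ i * pochhammer (- \<nu> - of_nat k) i"
      using pochhammer_minus'[of "\<nu> + of_nat k" i] that by (simp add: of_nat_diff algebra_simps)
    finally have 1: "?q k = ?q (k - i) * ((-1) ^ i * pochhammer (- \<nu> - of_nat k) i)" .
    have "(fact k :: 'a) = fact (k - i) * pochhammer (1 + of_nat (k - i)) i"
      using pochhammer_product'[of "1 :: 'a" "k - i" i] that by (simp add: pochhammer_fact del: of_nat_diff)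
    also have "pochhammer (1 + of_nat (k - i)) i = (-1) ^ i * pochhammer (- of_nat k :: 'a) i"
      using pochhammer_minus'[of "of_nat k :: 'a" i] that by (simp add: of_nat_diff algebra_simps)
    finally have 2: "(fact k :: 'a) = fact (k - i) * ((-1) ^ i * pochhammer (- of_nat k) i)" .
    have sq: "(-1) ^ i * (-1) ^ i = (1 :: 'a)" by (simp flip: power_mult_distrib)
    have 3: "1 / ?q (k - i) = ((-1) ^ i * pochhammer (- \<nu> - of_nat k) i) / ?q k"
      using 1 nz(1)[of k] nz(1)[of "k - i"] by (simp add: field_simps)
    have 4: "1 / fact (k - i) = ((-1) ^ i * pochhammer (- of_nat k) i) / (fact k :: 'a)"
    proof -
      \<comment> \<open>Here \<open>i \<le> k\<close> matters: this symbol vanishes from length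
        \<open>k + 1\<close> on.\<close>
      have "pochhammer (- of_nat k :: 'a) i \<noteq> 0"
        using that by (simp add: pochhammer_of_nat_eq_0_iff)
      then show ?thesis unfolding 2 by simp
    qed
    have "?c (2 * i) * ?c (2 * (k - i)) = (-1) ^ (i + (k - i)) / (4 ^ (i + (k - i)) * (fact i * ?q i)) *
        (1 / ?q (k - i)) * (1 / fact (k - i))"
      unfolding power_add by (simp add: cosb_def)
    also have "\<dots> = (-1) ^ k / (4 ^ k * (fact i * ?q i)) * ((-1) ^ i * (-1) ^ i) *
       (pochhammer (- \<nu> - of_nat k) i / ?q k) * (pochhammer (- of_nat k) i / fact k)"
      unfolding 3 4 using that by simp
    finally show ?thesis unfolding sq by (simp add: mult_ac)
  qed
  have double: "pochhammer (2 * \<nu> + 1) k * pochhammer (2 * \<nu> + 1 + of_nat k) k =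
      4 ^ k * pochhammer (\<nu> + 1 / 2) k * ?q k"
  proof -
    have "pochhammer (2 * \<nu> + 1) k * pochhammer (2 * \<nu> + 1 + of_nat k) k = pochhammer (2 * \<nu> + 1) (2 * k)"
      unfolding mult_2[of k] by (rule pochhammer_product'[symmetric])
    also have "\<dots> = pochhammer (2 * (\<nu> + 1 / 2)) (2 * k)" by simp
    also have "\<dots> = 4 ^ k * pochhammer (\<nu> + 1 / 2) k * ?q k"
      unfolding pochhammer_double by (simp add: power_mult add_ac)
    finally show ?thesis .
  qed
  have "fps_nth ((cosb \<nu>)\<^sup>2) (2 * k) = (\<Sum>i = 0..2 * k. ?c i * ?c (2 * k - i))"
    by (simp add: power2_eq_square fps_mult_nth)
  also have "\<dots> = (\<Sum>i\<in>(*) 2 ` {0..k}. ?c i * ?c (2 * k - i))"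
  proof (rule sum.mono_neutral_right, simp, force, safe)
    fix i assume "i \<in> {0..2 * k}" "i \<notin> (*) 2 ` {0..k}"
    then have "odd i" by (auto elim!: evenE)
    then show "?c i * ?c (2 * k - i) = 0" by (simp add: cosb_def)
  qed
  also have "\<dots> = (\<Sum>i = 0..k. ?c (2 * i) * ?c (2 * (k - i)))"
    by (subst sum.reindex) (auto simp: inj_on_def diff_mult_distrib2)
  also have "\<dots> = (-1) ^ k / (4 ^ k * fact k * ?q k) *
      (\<Sum>i = 0..k. pochhammer (- \<nu> - of_nat k) i * pochhammer (- of_nat k) i / (of_nat (fact i) * ?q i))"
    unfolding sum_distrib_left by (rule sum.cong) (use term_eq in auto)
  also have "\<dots> = (-1) ^ k / (4 ^ k * fact k * ?q k) *
      (pochhammer (2 * \<nu> + 1 + of_nat k) k / ?q k)"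
  proof (subst Vandermonde_pochhammer)
    show "\<forall>i\<in>{0..<k}. \<nu> + 1 \<noteq> - of_nat i"
      using nz(1)[of k] by (auto simp: pochhammer_eq_0_iff)
  qed (simp add: algebra_simps)
  also have "pochhammer (2 * \<nu> + 1 + of_nat k) k =
      4 ^ k * pochhammer (\<nu> + 1 / 2) k * ?q k / pochhammer (2 * \<nu> + 1) k"
    using double nz(2)[of k] by (simp add: field_simps)
  finally show "fps_nth ((cosb \<nu>)\<^sup>2) (2 * k) =
      (-1) ^ k * pochhammer (\<nu> + 1 / 2) k / (fact k * pochhammer (2 * \<nu> + 1) k * ?q k)"
    using nz by (simp add: field_simps)
qed

text \<open>The factor \<open>1 + X\<close> copies each even coefficient of the even series
  \<open>(cosb \<nu>)\<^sup>2\<close> to the next odd place, so that the two entries differ only by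
  the quotient of the factorials. The powers of 4 and the symbol in 1/2 come from
  \<open>fact (2 * k)\<close>.\<close>

lemma egf_coeff_f_nu:
  fixes \<nu> :: "'a::field_char_0"
  assumes nz: "\<And>n. pochhammer (\<nu> + 1) n \<noteq> 0" "\<And>n. pochhammer (2 * \<nu> + 1) n \<noteq> 0"
  shows "egf_coeff (f_nu \<nu>) (2 * k) = (-4) ^ k * pochhammer (1 / 2) k * pochhammer (\<nu> + 1 / 2) k /
      (pochhammer (2 * \<nu> + 1) k * pochhammer (\<nu> + 1) k)"
    and "egf_coeff (f_nu \<nu>) (Suc (2 * k)) = of_nat (Suc (2 * k)) * egf_coeff (f_nu \<nu>) (2 * k)"
proof -
  have even: "fps_nth (f_nu \<nu>) (2 * k) = fps_nth ((cosb \<nu>)\<^sup>2) (2 * k)"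
  proof (cases k)
    case (Suc l)
    then show ?thesis using cosb_square_nth(2)[OF nz, of l] by (simp add: f_nu_def distrib_right)
  qed (simp add: f_nu_def distrib_right)
  have odd: "fps_nth (f_nu \<nu>) (Suc (2 * k)) = fps_nth ((cosb \<nu>)\<^sup>2) (2 * k)"
    using cosb_square_nth(2)[OF nz, of k] by (simp add: f_nu_def distrib_right)
  have "(-4 :: 'a) ^ k = (-1) ^ k * 2 ^ (2 * k)"
    by (simp add: power_mult flip: power_mult_distrib)
  then show "egf_coeff (f_nu \<nu>) (2 * k) = (-4) ^ k * pochhammer (1 / 2) k * pochhammer (\<nu> + 1 / 2) k /
      (pochhammer (2 * \<nu> + 1) k * pochhammer (\<nu> + 1) k)"
    by (simp add: egf_coeff_def even cosb_square_nth[OF nz] fact_double)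
  show "egf_coeff (f_nu \<nu>) (Suc (2 * k)) = of_nat (Suc (2 * k)) * egf_coeff (f_nu \<nu>) (2 * k)"
    by (simp add: egf_coeff_def even odd)
qed

section \<open>Splitting the matrix entries into row, column and polynomial factors\<close>

definition row_scale :: "nat \<Rightarrow> 'a::field_char_0 \<Rightarrow> nat \<Rightarrow> 'a" where
  "row_scale N \<nu> i = (-4) ^ i * pochhammer (1 / 2) i * pochhammer (\<nu> + 1 / 2) i /
     (pochhammer (\<nu> + 1) (N - 1 + i) * pochhammer (2 * \<nu> + 1) (N - 1 + i))"

definition col_scale :: "nat \<Rightarrow> 'a::field_char_0" where
  "col_scale j = (if even j then 1 else 2) * (-4) ^ (j div 2)"

text \<open>The denominators in row \<open>i\<close> have lengths \<open>i + l\<close> with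
  \<open>l \<le> N - 1\<close>, so length \<open>N - 1 + i\<close> serves the whole row, and
  clearing it produces the cofactor polynomial. In an odd column the factor
  \<open>2 (i + l) + 1 = 2 (i + l + 1/2)\<close> supplies the 2 in \<open>col_scale\<close> and the
  extra linear factor of the odd Newton polynomial.\<close>

lemma egf_coeff_f_nu_factored:
  fixes \<nu> :: "'a::field_char_0"
  assumes nz: "\<And>n. pochhammer (\<nu> + 1) n \<noteq> 0" "\<And>n. pochhammer (2 * \<nu> + 1) n \<noteq> 0"
    and j: "j < 2 * N"
  shows "egf_coeff (f_nu \<nu>) (2 * i + j) = row_scale N \<nu> i * col_scale j *
    poly (newton (interlaced (1 / 2) (\<nu> + 1 / 2)) j *
      cofactor_poly N (2 * \<nu> + 1) (\<nu> + 1) (j div 2)) (of_nat i)"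
proof -
  define l where "l = j div 2"
  have l: "l < N" using j by (simp add: l_def less_mult_imp_div_less mult.commute)
  have split: "pochhammer e (i + l) = pochhammer e i * pochhammer (of_nat i + e) l" for e :: 'a
    using pochhammer_product'[of e i l] by (simp add: add.commute)
  have tail: "pochhammer e (N - 1 + i) = pochhammer e (i + l) * pochhammer (of_nat i + e + of_nat l) (N - 1 - l)"
    for e :: 'a
    using pochhammer_product'[of e "i + l" "N - 1 - l"] l by (simp add: algebra_simps)
  have tail_nz: "pochhammer (of_nat i + e + of_nat l) (N - 1 - l) \<noteq> 0" if "pochhammer e (N - 1 + i) \<noteq> 0" for e :: 'a
    using tail[of e] that by auto
  have even: "egf_coeff (f_nu \<nu>) (2 * i + 2 * l) = row_scale N \<nu> i * (-4) ^ l *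
      (poly (newton (interlaced (1 / 2) (\<nu> + 1 / 2)) (2 * l)) (of_nat i) *
       poly (cofactor_poly N (2 * \<nu> + 1) (\<nu> + 1) l) (of_nat i))"
  proof -
    have "egf_coeff (f_nu \<nu>) (2 * i + 2 * l) = (-4) ^ (i + l) * pochhammer (1 / 2) (i + l) * pochhammer (\<nu> + 1 / 2) (i + l) /
      (pochhammer (2 * \<nu> + 1) (i + l) * pochhammer (\<nu> + 1) (i + l))"
      using egf_coeff_f_nu(1)[OF nz, of "i + l"] by simp
    then show ?thesis
      unfolding row_scale_def poly_newton_interlaced poly_cofactor_poly tail
      using tail_nz[OF nz(1)] tail_nz[OF nz(2)] nz
      by (simp add: split[of "1 / 2"] split[of "\<nu> + 1 / 2"] power_add mult_ac)
  qed
  show ?thesis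
  proof (cases "even j")
    case True
    then have "j = 2 * l" by (simp add: l_def)
    then show ?thesis using even by (simp add: col_scale_def)
  next
    case False
    then have j: "j = Suc (2 * l)" by (simp add: l_def)
    have "poly (newton (interlaced (1 / 2) (\<nu> + 1 / 2)) j) (of_nat i) =
        (of_nat i + 1 / 2 + of_nat l) * poly (newton (interlaced (1 / 2) (\<nu> + 1 / 2)) (2 * l)) (of_nat i)"
      unfolding j poly_newton_interlaced by (simp add: pochhammer_Suc)
    moreover have "egf_coeff (f_nu \<nu>) (2 * i + j) =
        2 * (of_nat i + 1 / 2 + of_nat l) * egf_coeff (f_nu \<nu>) (2 * i + 2 * l)"
      using egf_coeff_f_nu(2)[OF nz, of "i + l"] by (simp add: j algebra_simps)
    ultimately show ?thesis using even by (simp add: col_scale_def j)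
  qed
qed

lemma prod_col_scale: "(\<Prod>j<2 * N. col_scale j) = (2 :: 'a::field_char_0) ^ ((2 * N) choose 2)"
proof (induction N)
  case (Suc N)
  \<comment> \<open>Columns \<open>2 N\<close> and \<open>2 N + 1\<close> together contribute
    \<open>2 * 16 ^ N\<close>, that is, \<open>4 N + 1\<close> factors 2; their signs
    cancel.\<close>
  have "(2 * Suc N) choose 2 = (2 * N choose 2) + (4 * N + 1)"
    by (cases N) (simp_all add: choose_two algebra_simps)
  moreover have "(\<Prod>j<2 * Suc N. col_scale j) = (\<Prod>j<2 * N. col_scale j) * (2 * ((-4) ^ N * (-4 :: 'a) ^ N))"
    by (simp add: col_scale_def)
  moreover have "(-4) ^ N * (-4 :: 'a) ^ N = 2 ^ (4 * N)"
    by (simp add: power_mult flip: power_mult_distrib)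
  ultimately show ?case using Suc by (simp add: power_add)
qed (simp add: choose_two)

text \<open>The second hypothesis fails at -1/2, -3/2, ..., where the product may divide by 0.
  Complex parameters are therefore reached by specialising the generic identity.\<close>

lemma hankel2_f_nu_eq_product_side:
  fixes \<nu> :: "'a::field_char_0"
  assumes nz: "\<And>n. pochhammer (\<nu> + 1) n \<noteq> 0" "\<And>n. pochhammer (2 * \<nu> + 1) n \<noteq> 0"
  shows "hankel2 (2 * N) (f_nu \<nu>) = product_side N \<nu>"
proof -
  let ?x = "interlaced (1 / 2) (\<nu> + 1 / 2)" and ?R = "cofactor_poly N (2 * \<nu> + 1) (\<nu> + 1)"
  \<comment> \<open>The sign is spread over the rows so that both sides of \<open>rows\<close> can
    be compared factor by factor.\<close>
  have sign: "(-1 :: 'a) ^ N = (\<Prod>i<2 * N. (-1) ^ i)"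
    by (simp add: prod_lessThan_double)
  have rows: "(\<Prod>i<2 * N. row_scale N \<nu> i) * (\<Prod>i<2 * N. fact i) =
      (-1) ^ N * (\<Prod>i<2 * N. fact (2 * i)) * (\<Prod>i<2 * N. pochhammer (\<nu> + 1 / 2) i /
        (pochhammer (\<nu> + 1) (N - 1 + i) * pochhammer (2 * \<nu> + 1) (N - 1 + i)))"
  proof -
    have "(-4 :: 'a) ^ i = (-1) ^ i * 2 ^ (2 * i)" for i
      by (simp add: power_mult flip: power_mult_distrib)
    then show ?thesis
      unfolding sign prod.distrib[symmetric]
      by (intro prod.cong) (simp_all add: row_scale_def fact_double)
  qed
  have "hankel2 (2 * N) (f_nu \<nu>) = det (mat (2 * N) (2 * N) (\<lambda>(i, j).
      row_scale N \<nu> i * col_scale j * poly (newton ?x j * ?R (j div 2)) (of_nat i)))"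
    unfolding hankel2_def
    by (intro arg_cong[of _ _ det] cong_mat) (simp_all add: egf_coeff_f_nu_factored[OF nz])
  also have "\<dots> = (\<Prod>i<2 * N. row_scale N \<nu> i) * (\<Prod>j<2 * N. col_scale j) * ((\<Prod>i<2 * N. fact i) *
    (\<Prod>k<N. pochhammer (2 * \<nu> + 1 - 1 / 2) k * pochhammer (\<nu> + 1 - 1 / 2) k *
      pochhammer (2 * \<nu> + 1 - (\<nu> + 1 / 2)) k * pochhammer (\<nu> + 1 - (\<nu> + 1 / 2)) k))"
    by (subst det_scale_rows_cols) (simp only: det_newton_cofactor)
  also have "\<dots> = ((\<Prod>i<2 * N. row_scale N \<nu> i) * (\<Prod>i<2 * N. fact i)) * 2 ^ ((2 * N) choose 2) *
    (\<Prod>k<N. pochhammer (1 / 2) k * (pochhammer (\<nu> + 1 / 2) k)\<^sup>2 * pochhammer (2 * \<nu> + 1 / 2) k)"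
  proof -
    have "2 * \<nu> + 1 - 1 / 2 = 2 * \<nu> + 1 / 2" "\<nu> + 1 - 1 / 2 = \<nu> + 1 / 2"
      "2 * \<nu> + 1 - (\<nu> + 1 / 2) = \<nu> + 1 / 2" "\<nu> + 1 - (\<nu> + 1 / 2) = 1 / 2"
      by (simp_all add: field_simps)
    then show ?thesis
      unfolding prod_col_scale power2_eq_square by (simp only: mult_ac)
  qed
  finally show ?thesis unfolding rows by (simp add: product_side_def mult_ac)
qed

subsection \<open>Evaluation of rational functions\<close>

definition has_value :: "complex \<Rightarrow> rat poly fract \<Rightarrow> complex \<Rightarrow> bool" where
  "has_value z r w \<longleftrightarrow> (\<exists>p q. r = Fraction_Field.Fract p q \<and> poly (map_poly of_rat q) z \<noteq> 0 \<and>
     w = poly (map_poly of_rat p) z / poly (map_poly of_rat q) z)"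

lemma map_poly_of_rat_simps:
  "map_poly of_rat (p + q) = (map_poly of_rat p + map_poly of_rat q :: complex poly)"
  "map_poly of_rat (p - q) = (map_poly of_rat p - map_poly of_rat q :: complex poly)"
  "map_poly of_rat (p * q) = (map_poly of_rat p * map_poly of_rat q :: complex poly)"
proof -
  show add: "map_poly of_rat (p + q) = (map_poly of_rat p + map_poly of_rat q :: complex poly)" for p q
    by (intro poly_eqI) (simp add: coeff_map_poly of_rat_add)
  show "map_poly of_rat (p - q) = (map_poly of_rat p - map_poly of_rat q :: complex poly)"
    by (intro poly_eqI) (simp add: coeff_map_poly of_rat_diff)
  have smult: "map_poly of_rat (smult a q) = (smult (of_rat a) (map_poly of_rat q) :: complex poly)" for a q
    by (intro poly_eqI) (simp add: coeff_map_poly of_rat_mult)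
  show "map_poly of_rat (p * q) = (map_poly of_rat p * map_poly of_rat q :: complex poly)"
    by (induction p) (simp_all add: map_poly_pCons add smult)
qed

text \<open>By coprimality the reduced denominator divides any other denominator, so it cannot
  vanish where that one does not. Cross-multiplication then identifies the values.\<close>

lemma has_value_imp:
  assumes "has_value z r w"
  shows "regular_at r z" "ratfun_value r z = w"
proof -
  let ?e = "\<lambda>p. poly (map_poly of_rat p) z"
  obtain p q where r: "r = Fraction_Field.Fract p q" and q: "?e q \<noteq> 0" and w: "w = ?e p / ?e q"
    using assms by (auto simp: has_value_def)
  obtain p' q' where pq': "quot_of_fract r = (p', q')" by (cases "quot_of_fract r")
  have "q' \<noteq> 0" using snd_quot_of_fract_nonzero[of r] by (simp add: pq')
  have "q \<noteq> 0" using q by auto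
  have cop: "coprime p' q'" using coprime_quot_of_fract[of r] by (simp add: pq')
  have "Fraction_Field.Fract p' q' = Fraction_Field.Fract p q"
    using Fract_quot_of_fract[of r] unfolding r[symmetric] by (simp add: pq')
  then have eq: "p' * q = p * q'"
    using \<open>q' \<noteq> 0\<close> \<open>q \<noteq> 0\<close> by (simp add: eq_fract)
  then have "q' dvd p' * q" by simp
  then have "q' dvd q" using cop by (simp add: coprime_commute coprime_dvd_mult_right_iff)
  then obtain t where "q = q' * t" by blast
  then have q': "?e q' \<noteq> 0" using q by (auto simp: map_poly_of_rat_simps)
  have "?e p' * ?e q = ?e p * ?e q'"
    using arg_cong[OF eq, of ?e] by (simp add: map_poly_of_rat_simps)
  then show "regular_at r z" "ratfun_value r z = w"
    using q q' by (simp_all add: regular_at_def ratfun_value_def pq' w frac_eq_eq)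
qed

lemma has_value_unique: "has_value z r w \<Longrightarrow> has_value z r w' \<Longrightarrow> w = w'"
  using has_value_imp(2) by blast

lemma has_value_nu_var: "has_value z nu_var z"
  unfolding has_value_def nu_var_def
  by (intro exI[of _ "[:0, 1:]"] exI[of _ 1]) (simp add: map_poly_pCons)

lemma has_value_0: "has_value z 0 0"
  unfolding has_value_def
  by (intro exI[of _ 0] exI[of _ 1]) (simp add: fract_collapse)

lemma has_value_1: "has_value z 1 1"
  unfolding has_value_def
  by (intro exI[of _ 1] exI[of _ 1]) (simp add: fract_collapse)

lemma has_value_arith:
  assumes "has_value z r w" "has_value z r' w'"
  shows has_value_add: "has_value z (r + r') (w + w')"
    and has_value_diff: "has_value z (r - r') (w - w')"
    and has_value_mult: "has_value z (r * r') (w * w')"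
proof -
  let ?e = "\<lambda>p. poly (map_poly of_rat p) z"
  obtain p q where r: "r = Fraction_Field.Fract p q" and q: "?e q \<noteq> 0" and w: "w = ?e p / ?e q"
    using assms(1) by (auto simp: has_value_def)
  obtain p' q' where r': "r' = Fraction_Field.Fract p' q'" and q': "?e q' \<noteq> 0" and w': "w' = ?e p' / ?e q'"
    using assms(2) by (auto simp: has_value_def)
  have nz: "q \<noteq> 0" "q' \<noteq> 0" using q q' by auto
  show "has_value z (r + r') (w + w')"
    unfolding has_value_def by (rule exI[of _ "p * q' + p' * q"], rule exI[of _ "q * q'"])
      (use nz q q' in \<open>simp add: r r' w w' map_poly_of_rat_simps add_frac_eq\<close>)
  show "has_value z (r - r') (w - w')"
    unfolding has_value_def by (rule exI[of _ "p * q' - p' * q"], rule exI[of _ "q * q'"])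
      (use nz q q' in \<open>simp add: r r' w w' map_poly_of_rat_simps diff_frac_eq\<close>)
  show "has_value z (r * r') (w * w')"
    unfolding has_value_def by (rule exI[of _ "p * p'"], rule exI[of _ "q * q'"])
      (use nz q q' in \<open>simp add: r r' w w' map_poly_of_rat_simps\<close>)
qed

lemma has_value_inverse:
  assumes "has_value z r w" "w \<noteq> 0"
  shows "has_value z (inverse r) (inverse w)"
proof -
  let ?e = "\<lambda>p. poly (map_poly of_rat p) z"
  obtain p q where r: "r = Fraction_Field.Fract p q" and q: "?e q \<noteq> 0" and w: "w = ?e p / ?e q"
    using assms(1) by (auto simp: has_value_def)
  show ?thesis
    unfolding has_value_def by (rule exI[of _ q], rule exI[of _ p])
      (use assms q in \<open>auto simp: r w\<close>)
qed

lemma has_value_divide: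
  "has_value z r w \<Longrightarrow> has_value z r' w' \<Longrightarrow> w' \<noteq> 0 \<Longrightarrow> has_value z (r / r') (w / w')"
  unfolding divide_inverse by (intro has_value_mult has_value_inverse)

lemma has_value_minus: "has_value z r w \<Longrightarrow> has_value z (- r) (- w)"
  using has_value_diff[OF has_value_0, of z r w] by simp

lemma has_value_of_nat: "has_value z (of_nat n) (of_nat n)"
  by (induction n) (auto intro: has_value_0 has_value_1 has_value_add)

lemma has_value_numeral: "has_value z (numeral n) (numeral n)"
  using has_value_of_nat[of z "numeral n"] by simp

lemma has_value_fact: "has_value z (fact n) (fact n)"
  using has_value_of_nat[of z "fact n"] by simp

lemma has_value_power: "has_value z r w \<Longrightarrow> has_value z (r ^ n) (w ^ n)"
  by (induction n) (auto intro: has_value_1 has_value_mult)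

lemma has_value_sum:
  "(\<And>i. i \<in> A \<Longrightarrow> has_value z (f i) (g i)) \<Longrightarrow> has_value z (sum f A) (sum g A)"
  by (induction A rule: infinite_finite_induct) (auto intro: has_value_0 has_value_add)

lemma has_value_prod:
  "(\<And>i. i \<in> A \<Longrightarrow> has_value z (f i) (g i)) \<Longrightarrow> has_value z (prod f A) (prod g A)"
  by (induction A rule: infinite_finite_induct) (auto intro: has_value_1 has_value_mult)

lemma has_value_pochhammer: "has_value z r w \<Longrightarrow> has_value z (pochhammer r n) (pochhammer w n)"
  unfolding pochhammer_prod by (intro has_value_prod has_value_add has_value_of_nat)

lemma has_value_det:
  assumes "\<And>i j. i < n \<Longrightarrow> j < n \<Longrightarrow> has_value z (A i j) (B i j)"
  shows "has_value z (det (mat n n (\<lambda>(i, j). A i j))) (det (mat n n (\<lambda>(i, j). B i j)))"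
proof -
  have "has_value z (signof p) (signof p)" for p :: "nat \<Rightarrow> nat"
    by (simp add: sign_def has_value_1 has_value_minus)
  moreover have "p i < n" if "p permutes {0..<n}" "i < n" for p i
    using permutes_in_image[OF that(1)] that(2) by auto
  ultimately show ?thesis
    by (subst (1 2) det_def'[of _ n])
      (auto intro!: has_value_sum has_value_mult has_value_prod assms)
qed

section \<open>Specialisation of the Hankel determinant\<close>

lemma has_value_cosb:
  assumes "\<And>n. pochhammer (z + 1) n \<noteq> 0"
  shows "has_value z (fps_nth (cosb nu_var) n) (fps_nth (cosb z) n)"
  using assms unfolding cosb_def
  by (auto intro!: has_value_0 has_value_divide has_value_mult has_value_power has_value_minus
      has_value_1 has_value_numeral has_value_fact has_value_pochhammer has_value_add has_value_nu_var)

text \<open>The series is handled through its definition, whose denominators contain symbols in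
  \<open>\<nu> + 1\<close> alone; the closed form of the square would also bring in
  \<open>2 * \<nu> + 1\<close> and exclude half-integers.\<close>

lemma has_value_hankel2_f_nu:
  assumes "\<And>n. pochhammer (z + 1) n \<noteq> 0"
  shows "has_value z (hankel2 n (f_nu nu_var)) (hankel2 n (f_nu z))"
proof -
  have sq: "has_value z (fps_nth ((cosb nu_var)\<^sup>2) n) (fps_nth ((cosb z)\<^sup>2) n)" for n
    unfolding power2_eq_square fps_mult_nth
    by (intro has_value_sum has_value_mult has_value_cosb assms)
  have "has_value z (fps_nth (f_nu nu_var) n) (fps_nth (f_nu z) n)" for n
    using sq by (cases n) (auto simp: f_nu_def distrib_right intro!: has_value_add)
  then show ?thesis
    unfolding hankel2_def egf_coeff_def
    by (intro has_value_det has_value_mult has_value_fact)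
qed

text \<open>Evaluation at 1 gives the positive integer \<open>a + n + 1\<close>, whereas the zero
  function has the value 0.\<close>

lemma linear_nu_var_neq_0:
  assumes "a > 0"
  shows "of_nat a * nu_var + of_nat n + 1 \<noteq> 0"
proof
  assume eq: "of_nat a * nu_var + of_nat n + 1 = 0"
  have "has_value 1 (of_nat a * nu_var + of_nat n + 1) (of_nat a * 1 + of_nat n + 1)"
    by (intro has_value_add has_value_mult has_value_of_nat has_value_nu_var has_value_1)
  then have "of_nat a * 1 + of_nat n + 1 = (0 :: complex)"
    unfolding eq using has_value_0 by (rule has_value_unique)
  then have "of_nat (a + n + 1) = (0 :: complex)" by (simp add: add_ac)
  then show False unfolding of_nat_eq_0_iff by simp
qed

theorem theorem25p4:
  fixes N :: nat
  assumes "N \<ge> 1"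
  shows "hankel2 (2 * N) (f_nu nu_var) = product_side N nu_var \<and>
    (\<forall>z::complex. z \<notin> {- of_nat k | k::nat. k \<ge> 1} \<longrightarrow>
       regular_at (hankel2 (2 * N) (f_nu nu_var)) z \<and>
       ratfun_value (hankel2 (2 * N) (f_nu nu_var)) z = hankel2 (2 * N) (f_nu z) \<and>
       regular_at (product_side N nu_var) z \<and>
       hankel2 (2 * N) (f_nu z) = ratfun_value (product_side N nu_var) z)"
proof -
  have nu: "pochhammer (nu_var + 1) n \<noteq> 0" "pochhammer (2 * nu_var + 1) n \<noteq> 0" for n
    using linear_nu_var_neq_0[of 1] linear_nu_var_neq_0[of 2]
    by (auto simp: pochhammer_eq_0_iff eq_neg_iff_add_eq_0 add_ac)
  have generic: "hankel2 (2 * N) (f_nu nu_var) = product_side N nu_var"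
    using nu by (rule hankel2_f_nu_eq_product_side)
  \<comment> \<open>Only the determinant is specialised directly. Regularity and value of the
    product side are inherited through \<open>generic\<close>, which takes care of the cancellations
    at half-integers.\<close>
  have "has_value z (hankel2 (2 * N) (f_nu nu_var)) (hankel2 (2 * N) (f_nu z))"
    if z: "z \<notin> {- of_nat k | k::nat. k \<ge> 1}" for z
  proof (rule has_value_hankel2_f_nu)
    show "pochhammer (z + 1) n \<noteq> 0" for n
    proof
      assume "pochhammer (z + 1) n = 0"
      then obtain k where "z + 1 = - of_nat k" by (auto simp: pochhammer_eq_0_iff)
      then have "z = - of_nat k - 1" by (rule eq_diff_eq[THEN iffD2])
      then have "z = - of_nat (Suc k)" by simp
      with z show False by force
    qed
  qed
  then show ?thesis
    unfolding generic[symmetric] using has_value_imp by (metis (lifting))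
qed

end
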